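(* Let $D\ge 1$ and $0<x<2D$. There is no uniform deterministic consensus algorithm (i.e., no single algorithm, which may depend on $D$ and $x$ but not on the number $n$ of processes, that for every $n$ solves consensus in every system of $n$ processes) under the message adversary $\lozenge\mathrm{STABLE}_D(x)$.
   Context: Model: a finite set $\Pi$ of $n$ processes with unique identifiers, which never fail and run in lock-step synchronous rounds $r=1,2,\dots$; in each round every process sends a message to every other process, receives some of them, and makes a local state transition. The round-$r$ communication graph $\mathcal{G}^r$ is a directed graph on $\Pi$ with edge $(p\to q)$ iff $q$ receives $p$'s round-$r$ message; all self-loops are always present. A message adversary is a set of infinite sequences of communication graphs (the admissible sequences); an algorithm solves consensus under a message adversary if for every assignment of inputs and every admissible sequence the run satisfies: Termination (every process eventually irrevocably decides), Agreement (all decisions are equal), Validity (every decision is some process's input). Processes know $D$ and $x$. A root component of a graph $\mathcal{G}$ is a nonempty $R\subseteq\Pi$ that is the vertex set of a strongly connected component of $\mathcal{G}$ with no edge $(p\to q)$, $q\in R$, $p\notin R$. A graph is rooted if it has exactly one root component $\operatorname{Root}(\mathcal{G})$. A nonempty sequence of consecutive graphs is $R$-rooted if each graph in it is rooted with root component $R$. Compound graph: $(p,q)\in\mathcal{G}\circ\mathcal{G}'$ iff $(p,p')\in\mathcal{G}$ and $(p',q)\in\mathcal{G}'$ for some $p'$. Causal past: $\mathrm{CP}_p(a,a)=\{p\}$ and, for $a<b$, $\mathrm{CP}_p(a,b)$ is the set of in-neighbours of $p$ in $\mathcal{G}^{a+1}\circ\cdots\circ\mathcal{G}^b$. $\mathrm{DIAM}(D)$: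 all sequences such that for every subsequence $\mathcal{G}^{r_1},\dots,\mathcal{G}^{r_1+D-1}$ of $D$ consecutive graphs that is $R$-rooted, $R\subseteq \mathrm{CP}_p(r_1-1,r_1+D-1)$ for every $p\in\Pi$. $\lozenge\mathrm{STABILITY}(x)$: all sequences containing, for some $R\subseteq\Pi$, an $R$-rooted subsequence of at least $x$ consecutive graphs. $\mathrm{ROOTED}$: all sequences in which every graph is rooted. $\lozenge\mathrm{STABLE}_D(x)=\mathrm{ROOTED}\cap\lozenge\mathrm{STABILITY}(x)\cap\mathrm{DIAM}(D)$. *)

theory Defs
  imports Main
begin

text \<open>Processes are identified by natural numbers; a system is a finite nonempty
  set Pi of identifiers. Round r (r >= 1) has communication graph G r, a set of
  directed edges (p,q) meaning q receives p's round-r message.\<close>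

text \<open>A deterministic uniform algorithm for binary consensus: it does not get n.
  init p v: initial state of process p with input v; alg_msg s: message broadcast
  in state s; alg_step s rcv: new state given received messages (rcv p = Some m iff
  the message m of p was received); alg_dec s: decision recorded in state s.\<close>
record ('s, 'm) cons_alg =
  alg_init :: "nat \<Rightarrow> bool \<Rightarrow> 's"
  alg_msg  :: "'s \<Rightarrow> 'm"
  alg_step :: "'s \<Rightarrow> (nat \<Rightarrow> 'm option) \<Rightarrow> 's"
  alg_dec  :: "'s \<Rightarrow> bool option"

text \<open>run A Pi inp G r p: state of process p after r rounds.\<close>
primrec run :: "('s, 'm) cons_alg \<Rightarrow> nat set \<Rightarrow> (nat \<Rightarrow> bool) \<Rightarrow> (nat \<Rightarrow> (nat \<times> nat) set)
                 \<Rightarrow> nat \<Rightarrow> nat \<Rightarrow> 's" where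
  "run A Pi inp G 0 = (\<lambda>p. alg_init A p (inp p))"
| "run A Pi inp G (Suc r) = (\<lambda>q. alg_step A (run A Pi inp G r q)
      (\<lambda>p. if p \<in> Pi \<and> (p, q) \<in> G (Suc r) then Some (alg_msg A (run A Pi inp G r p)) else None))"

definition graph_seq :: "nat set \<Rightarrow> (nat \<Rightarrow> (nat \<times> nat) set) \<Rightarrow> bool" where
  "graph_seq Pi G \<longleftrightarrow> (\<forall>r\<ge>1. G r \<subseteq> Pi \<times> Pi \<and> (\<forall>p\<in>Pi. (p, p) \<in> G r))"

text \<open>R is the vertex set of a strongly connected component of graph E on Pi.\<close>
definition is_scc :: "nat set \<Rightarrow> (nat \<times> nat) set \<Rightarrow> nat set \<Rightarrow> bool" where
  "is_scc Pi E R \<longleftrightarrow> R \<noteq> {} \<and> R \<subseteq> Pi \<and>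
     (\<forall>p\<in>R. \<forall>q. q \<in> R \<longleftrightarrow> (q \<in> Pi \<and> (p, q) \<in> E\<^sup>* \<and> (q, p) \<in> E\<^sup>*))"

definition is_root_comp :: "nat set \<Rightarrow> (nat \<times> nat) set \<Rightarrow> nat set \<Rightarrow> bool" where
  "is_root_comp Pi E R \<longleftrightarrow> is_scc Pi E R \<and> (\<forall>p q. (p, q) \<in> E \<and> q \<in> R \<and> p \<notin> R \<longrightarrow> False)"

text \<open>E is rooted with (unique) root component R.\<close>
definition rooted_with :: "nat set \<Rightarrow> (nat \<times> nat) set \<Rightarrow> nat set \<Rightarrow> bool" where
  "rooted_with Pi E R \<longleftrightarrow> is_root_comp Pi E R \<and> (\<forall>R'. is_root_comp Pi E R' \<longrightarrow> R' = R)"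

definition rooted :: "nat set \<Rightarrow> (nat \<times> nat) set \<Rightarrow> bool" where
  "rooted Pi E \<longleftrightarrow> (\<exists>R. rooted_with Pi E R)"

text \<open>cpk G a p k = CP_p(a, a+k): in-neighbours of p in G(a+1) o ... o G(a+k).\<close>
primrec cpk :: "(nat \<Rightarrow> (nat \<times> nat) set) \<Rightarrow> nat \<Rightarrow> nat \<Rightarrow> nat \<Rightarrow> nat set" where
  "cpk G a p 0 = {p}"
| "cpk G a p (Suc k) = {q. \<exists>y. (y, p) \<in> G (a + Suc k) \<and> q \<in> cpk G a y k}"

definition CP :: "(nat \<Rightarrow> (nat \<times> nat) set) \<Rightarrow> nat \<Rightarrow> nat \<Rightarrow> nat \<Rightarrow> nat set" where
  "CP G p a b = cpk G a p (b - a)"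

definition DIAM :: "nat \<Rightarrow> nat set \<Rightarrow> (nat \<Rightarrow> (nat \<times> nat) set) \<Rightarrow> bool" where
  "DIAM D Pi G \<longleftrightarrow> (\<forall>r1\<ge>1. \<forall>R. (\<forall>r\<in>{r1..<r1 + D}. rooted_with Pi (G r) R) \<longrightarrow>
       (\<forall>p\<in>Pi. R \<subseteq> CP G p (r1 - 1) (r1 + D - 1)))"

definition EV_STABILITY :: "nat \<Rightarrow> nat set \<Rightarrow> (nat \<Rightarrow> (nat \<times> nat) set) \<Rightarrow> bool" where
  "EV_STABILITY x Pi G \<longleftrightarrow> (\<exists>R r1. r1 \<ge> 1 \<and> (\<forall>r\<in>{r1..<r1 + x}. rooted_with Pi (G r) R))"

definition ROOTED :: "nat set \<Rightarrow> (nat \<Rightarrow> (nat \<times> nat) set) \<Rightarrow> bool" where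
  "ROOTED Pi G \<longleftrightarrow> (\<forall>r\<ge>1. rooted Pi (G r))"

text \<open>Admissible sequences of the message adversary Eventually-STABLE_D(x) on Pi.\<close>
definition EV_STABLE :: "nat \<Rightarrow> nat \<Rightarrow> nat set \<Rightarrow> (nat \<Rightarrow> (nat \<times> nat) set) \<Rightarrow> bool" where
  "EV_STABLE D x Pi G \<longleftrightarrow> graph_seq Pi G \<and> ROOTED Pi G \<and> EV_STABILITY x Pi G \<and> DIAM D Pi G"

definition solves_consensus :: "('s, 'm) cons_alg \<Rightarrow> nat set \<Rightarrow> ((nat \<Rightarrow> (nat \<times> nat) set) \<Rightarrow> bool) \<Rightarrow> bool" where
  "solves_consensus A Pi MA \<longleftrightarrow> (\<forall>inp G. MA G \<longrightarrow>
     (let st = run A Pi inp G in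
       (\<forall>p\<in>Pi. \<exists>r v. alg_dec A (st r p) = Some v) \<and>
       (\<forall>p\<in>Pi. \<forall>r r' v. r \<le> r' \<longrightarrow> alg_dec A (st r p) = Some v \<longrightarrow> alg_dec A (st r' p) = Some v) \<and>
       (\<forall>p\<in>Pi. \<forall>q\<in>Pi. \<forall>r r' v w. alg_dec A (st r p) = Some v \<longrightarrow> alg_dec A (st r' q) = Some w \<longrightarrow> v = w) \<and>
       (\<forall>p\<in>Pi. \<forall>r v. alg_dec A (st r p) = Some v \<longrightarrow> (\<exists>q\<in>Pi. inp q = v))))"

end

theory Submission
  imports Defs
begin

text \<open>For \<open>D \<ge> 2\<close>, let \<open>D + 1\<close> be the root of a path during the first \<open>2 * D - 1\<close> rounds, and
  let the root afterwards alternate between two twins 0 and 1 at the far end. With all inputs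
  False, process 0 decides False by some round \<open>T\<close>. At distance \<open>D\<close>, the twins have verified only
  \<open>D - 1\<close> of the stable rounds. So the same view arises in a larger system where no root lasts \<open>D\<close>
  rounds until \<open>T\<close>, which makes the diameter condition vacuous up to then and allows a tail of more
  than \<open>T\<close> processes with input True. The end of the tail becomes the eternal root after round \<open>T\<close>
  without ever having heard of an input False, hence decides True.

  For \<open>D = 1\<close>, two processes with a lossy link already defeat every algorithm, by a bivalence
  argument.\<close>

section \<open>Rooted graphs\<close>

lemma rtrancl_pred_closed:
  assumes "(p, q) \<in> E\<^sup>*" and "q \<in> R" and "\<And>p q. (p, q) \<in> E \<Longrightarrow> q \<in> R \<Longrightarrow> p \<in> R"
  shows "p \<in> R"
  using assms(1,2) by (induction rule: converse_rtrancl_induct) (auto intro: assms(3))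

text \<open>Any root component contains all ancestors of its members, hence meets \<open>R\<close>;
  it is then the strongly connected component of a member of \<open>R\<close>, which is
  \<open>R\<close> itself.\<close>

lemma rooted_withI:
  assumes "R \<noteq> {}" and "R \<subseteq> Pi"
    and reach: "\<And>p q. p \<in> R \<Longrightarrow> q \<in> Pi \<Longrightarrow> (p, q) \<in> E\<^sup>*"
    and closed: "\<And>p q. (p, q) \<in> E \<Longrightarrow> q \<in> R \<Longrightarrow> p \<in> R"
  shows "rooted_with Pi E R"
  unfolding rooted_with_def
proof (intro conjI allI impI)
  have "q \<in> R \<longleftrightarrow> q \<in> Pi \<and> (p, q) \<in> E\<^sup>* \<and> (q, p) \<in> E\<^sup>*" if "p \<in> R" for p q
    using that reach rtrancl_pred_closed[of q p E R] closed assms(2) by blast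
  then show "is_root_comp Pi E R"
    using assms(1,2) closed unfolding is_root_comp_def is_scc_def by blast
  fix R' assume R': "is_root_comp Pi E R'"
  then have scc: "is_scc Pi E R'" and cl': "\<And>p q. (p, q) \<in> E \<Longrightarrow> q \<in> R' \<Longrightarrow> p \<in> R'"
    unfolding is_root_comp_def by blast+
  obtain r where r: "r \<in> R" using assms(1) by blast
  obtain p where p: "p \<in> R'" "p \<in> Pi" using scc unfolding is_scc_def by blast
  have "r \<in> R'" using rtrancl_pred_closed[OF reach[OF r p(2)] p(1)] cl' by blast
  then have *: "q \<in> R' \<longleftrightarrow> q \<in> Pi \<and> (r, q) \<in> E\<^sup>* \<and> (q, r) \<in> E\<^sup>*" for q
    using scc unfolding is_scc_def by blast
  show "R' = R"
    using * r reach assms(2) rtrancl_pred_closed[of _ r E R] closed by blast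
qed

lemma rooted_with_unique: "rooted_with Pi E R \<Longrightarrow> rooted_with Pi E R' \<Longrightarrow> R = R'"
  unfolding rooted_with_def by blast

lemma cpk_self: "(\<And>r. r \<ge> 1 \<Longrightarrow> (p, p) \<in> G r) \<Longrightarrow> p \<in> cpk G a p k"
  by (induction k) auto

section \<open>Graphs in which each process has one parent\<close>

definition parent_graph :: "nat \<Rightarrow> (nat \<Rightarrow> nat) \<Rightarrow> (nat \<times> nat) set" where
  "parent_graph n f = {(p, q). q \<le> n \<and> (p = q \<or> p = f q)}"

lemma in_parent_graph: "(p, q) \<in> parent_graph n f \<longleftrightarrow> q \<le> n \<and> (p = q \<or> p = f q)"
  by (simp add: parent_graph_def)

lemma graph_seq_parent_graph:
  assumes "\<And>r. r \<ge> 1 \<Longrightarrow> \<exists>f. G r = parent_graph n f \<and> (\<forall>q\<le>n. f q \<le> n)"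
  shows "graph_seq {..n} G"
  unfolding graph_seq_def
proof (intro allI impI)
  fix r :: nat assume "1 \<le> r"
  then obtain f where "G r = parent_graph n f" "\<forall>q\<le>n. f q \<le> n" using assms by blast
  then show "G r \<subseteq> {..n} \<times> {..n} \<and> (\<forall>p\<in>{..n}. (p, p) \<in> G r)"
    by (auto simp: in_parent_graph)
qed

text \<open>The measure \<open>m\<close> drops along parents, so every chain of parents ends at the
  root.\<close>

lemma rooted_with_parent_graph:
  assumes "\<rho> \<le> n" and "f \<rho> = \<rho>"
    and dec: "\<And>q. q \<le> n \<Longrightarrow> q \<noteq> \<rho> \<Longrightarrow> f q \<le> n \<and> (m (f q) :: nat) < m q"
  shows "rooted_with {..n} (parent_graph n f) {\<rho>}"
proof (rule rooted_withI)
  have "(\<rho>, q) \<in> (parent_graph n f)\<^sup>*" if "q \<le> n" for q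
    using that
  proof (induction "m q" arbitrary: q rule: less_induct)
    case less
    show ?case
    proof (cases "q = \<rho>")
      case False
      then have "(\<rho>, f q) \<in> (parent_graph n f)\<^sup>*" using less dec by blast
      moreover have "(f q, q) \<in> parent_graph n f" using less.prems by (simp add: in_parent_graph)
      ultimately show ?thesis by (rule rtrancl.rtrancl_into_rtrancl)
    qed simp
  qed
  then show "\<And>p q. p \<in> {\<rho>} \<Longrightarrow> q \<in> {..n} \<Longrightarrow> (p, q) \<in> (parent_graph n f)\<^sup>*" by simp
qed (use assms(1,2) in \<open>auto simp: in_parent_graph\<close>)

abbreviation star :: "nat \<Rightarrow> nat \<Rightarrow> (nat \<times> nat) set" where
  "star n c \<equiv> parent_graph n (\<lambda>_. c)"

lemma rooted_with_star: "c \<le> n \<Longrightarrow> rooted_with {..n} (star n c) {c}"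
  by (rule rooted_with_parent_graph[where m = "\<lambda>q. if q = c then 0 else 1"]) auto

section \<open>Views and decisions\<close>

definition decides :: "('s, 'm) cons_alg \<Rightarrow> nat set \<Rightarrow> (nat \<Rightarrow> bool) \<Rightarrow> (nat \<Rightarrow> (nat \<times> nat) set)
    \<Rightarrow> nat \<Rightarrow> bool \<Rightarrow> bool" where
  "decides A Pi inp G p v \<longleftrightarrow> (\<exists>r. alg_dec A (run A Pi inp G r p) = Some v)"

lemma consensus_termination:
  "solves_consensus A Pi MA \<Longrightarrow> MA G \<Longrightarrow> p \<in> Pi \<Longrightarrow> \<exists>v. decides A Pi inp G p v"
  unfolding solves_consensus_def decides_def Let_def by meson

lemma consensus_agreement:
  "solves_consensus A Pi MA \<Longrightarrow> MA G \<Longrightarrow> p \<in> Pi \<Longrightarrow> q \<in> Pi \<Longrightarrow>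
    decides A Pi inp G p v \<Longrightarrow> decides A Pi inp G q w \<Longrightarrow> v = w"
  unfolding solves_consensus_def decides_def Let_def by meson

lemma consensus_validity:
  "solves_consensus A Pi MA \<Longrightarrow> MA G \<Longrightarrow> p \<in> Pi \<Longrightarrow>
    decides A Pi inp G p v \<Longrightarrow> \<exists>q\<in>Pi. inp q = v"
  unfolding solves_consensus_def decides_def Let_def by meson

lemma consensus_unanimous:
  assumes "solves_consensus A Pi MA" and "MA G" and "p \<in> Pi" and "\<And>q. q \<in> Pi \<Longrightarrow> inp q = v"
  shows "decides A Pi inp G p v"
proof -
  obtain w where w: "decides A Pi inp G p w" using consensus_termination[OF assms(1-3)] by blast
  then show ?thesis using consensus_validity[OF assms(1-3) w] assms(4) by auto
qed

text \<open>The set \<open>S r\<close> consists of processes whose causal past up to round \<open>r\<close> is the same in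
  both systems; it must contain everything its members hear.\<close>

lemma run_same_view:
  assumes init: "\<And>q. q \<in> S 0 \<Longrightarrow> inp q = inp' q"
    and mono: "\<And>r q. q \<in> S (Suc r) \<Longrightarrow> q \<in> S r"
    and same: "\<And>r p q. q \<in> S (Suc r) \<Longrightarrow>
        p \<in> Pi \<and> (p, q) \<in> G (Suc r) \<longleftrightarrow> p \<in> Pi' \<and> (p, q) \<in> G' (Suc r)"
    and closed: "\<And>r p q. q \<in> S (Suc r) \<Longrightarrow> p \<in> Pi \<Longrightarrow> (p, q) \<in> G (Suc r) \<Longrightarrow> p \<in> S r"
  shows "q \<in> S r \<Longrightarrow> run A Pi inp G r q = run A Pi' inp' G' r q"
proof (induction r arbitrary: q)
  case 0
  then show ?case by (simp add: init)
next
  case (Suc r)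
  have "(if p \<in> Pi \<and> (p, q) \<in> G (Suc r) then Some (alg_msg A (run A Pi inp G r p)) else None) =
     (if p \<in> Pi' \<and> (p, q) \<in> G' (Suc r) then Some (alg_msg A (run A Pi' inp' G' r p)) else None)" for p
    using same[OF Suc.prems, of p] closed[OF Suc.prems, of p] Suc.IH[of p] by auto
  then show ?case using Suc.IH[OF mono[OF Suc.prems]] by simp
qed

section \<open>The case of dynamic diameter one\<close>

definition root_after :: "(nat \<Rightarrow> (nat \<times> nat) set) \<Rightarrow> nat \<Rightarrow> nat \<Rightarrow> nat \<Rightarrow> (nat \<times> nat) set" where
  "root_after G r p = (\<lambda>k. if k \<le> r then G k else star 1 p)"

text \<open>The classical lossy link: in each round at most one of the two messages is lost.\<close>

definition lossy_link :: "(nat \<Rightarrow> (nat \<times> nat) set) \<Rightarrow> bool" where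
  "lossy_link G \<longleftrightarrow> (\<forall>r. G r \<in> {star 1 0, star 1 1, parent_graph 1 (\<lambda>q. 1 - q)})"

lemma le_1_cases: "(q::nat) \<le> 1 \<longleftrightarrow> q = 0 \<or> q = 1" by auto

lemma rooted_with_both: "rooted_with {..1} (parent_graph 1 (\<lambda>q. 1 - q)) {..1}"
  by (rule rooted_withI) (auto simp: in_parent_graph le_1_cases intro!: r_into_rtrancl)

text \<open>Each root reaches everybody within its own round, and a single round already counts as
  stable.\<close>

lemma EV_STABLE_lossy_link:
  assumes "lossy_link G"
  shows "EV_STABLE 1 1 {..1} G"
proof -
  have root: "\<exists>R. rooted_with {..1} (G r) R \<and> (\<forall>p\<le>1. \<forall>c\<in>R. (c, p) \<in> G r)" for r
  proof -
    consider "G r = star 1 0" | "G r = star 1 1" | "G r = parent_graph 1 (\<lambda>q. 1 - q)"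
      using assms unfolding lossy_link_def by blast
    then show ?thesis
    proof cases
      case 1
      then show ?thesis using rooted_with_star[of 0 1]
        by (intro exI[of _ "{0}"]) (auto simp: in_parent_graph)
    next
      case 2
      then show ?thesis using rooted_with_star[of 1 1]
        by (intro exI[of _ "{1}"]) (auto simp: in_parent_graph)
    next
      case 3
      then have "\<forall>p\<le>1. \<forall>c\<in>{..1}. (c, p) \<in> G r" by (auto simp: in_parent_graph)
      then show ?thesis using rooted_with_both 3 by metis
    qed
  qed
  have "graph_seq {..1} G"
  proof (rule graph_seq_parent_graph)
    fix r
    have "G r = star 1 0 \<or> G r = star 1 1 \<or> G r = parent_graph 1 (\<lambda>q. 1 - q)"
      using assms unfolding lossy_link_def by blast
    then show "\<exists>f. G r = parent_graph 1 f \<and> (\<forall>q\<le>1. f q \<le> 1)"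
      by (elim disjE) (rule exI, rule conjI, assumption, simp)+
  qed
  moreover have "ROOTED {..1} G" unfolding ROOTED_def rooted_def using root by blast
  moreover have "EV_STABILITY 1 {..1} G"
    unfolding EV_STABILITY_def using root[of 1] by (auto intro!: exI[of _ 1])
  moreover have "DIAM 1 {..1} G"
    unfolding DIAM_def CP_def
  proof (intro allI impI ballI subsetI)
    fix r1 R p c
    assume r1: "1 \<le> r1" and "\<forall>r\<in>{r1..<r1 + 1}. rooted_with {..1} (G r) R" "p \<in> {..1::nat}" "c \<in> R"
    then have "(c, p) \<in> G r1" using root[of r1] rooted_with_unique by force
    then show "c \<in> cpk G (r1 - 1) p (r1 + 1 - 1 - (r1 - 1))" using r1 by simp
  qed
  ultimately show ?thesis unfolding EV_STABLE_def by blast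
qed

lemma run_root_after:
  "k \<le> r \<Longrightarrow> run A Pi inp (root_after G r p) k q = run A Pi inp G k q"
  by (rule run_same_view[where S = "\<lambda>k. if k \<le> r then UNIV else {}"])
    (auto simp: root_after_def split: if_splits)

text \<open>Isolated after round \<open>Suc r\<close>, process \<open>p\<close> depends only on the
  common prefix and on what it hears itself in round \<open>Suc r\<close>.\<close>

lemma decides_root_after_cong:
  assumes "p \<le> 1" and "\<And>k. 1 \<le> k \<Longrightarrow> k \<le> r \<Longrightarrow> G k = G' k"
    and "\<And>q. q \<le> 1 \<Longrightarrow> (q, p) \<in> G (Suc r) \<longleftrightarrow> (q, p) \<in> G' (Suc r)"
  shows "decides A {..1} inp (root_after G (Suc r) p) p v =
    decides A {..1} inp (root_after G' (Suc r) p) p v"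
proof -
  have "run A {..1} inp (root_after G (Suc r) p) k p = run A {..1} inp (root_after G' (Suc r) p) k p" for k
    by (rule run_same_view[where S = "\<lambda>k. if k \<le> r then {..1} else {p}"])
      (use assms in \<open>auto simp: root_after_def in_parent_graph le_Suc_eq split: if_splits\<close>)
  then show ?thesis unfolding decides_def by simp
qed

lemma no_consensus_lossy_link:
  "\<not> solves_consensus A {..1} (EV_STABLE 1 1 {..1})"
proof
  assume sol: "solves_consensus A {..1} (EV_STABLE 1 1 {..1})"
  define inp where "inp = (\<lambda>q::nat. q = 1)"
  \<comment> \<open>A prefix is bivalent if the decision depends on which process is cut off from the other one
    forever afterwards; that decision is a function of the view of the isolated process.\<close>
  define dec where "dec = (\<lambda>G r p v. decides A {..1} inp (root_after G r p) p v)"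
  define bival where "bival = (\<lambda>r G. lossy_link G \<and> (\<exists>v. dec G r 0 v \<and> dec G r 1 (\<not> v)))"
  have adm: "EV_STABLE 1 1 {..1} (root_after G r p)" if "lossy_link G" "p \<le> 1" for G r p
  proof (rule EV_STABLE_lossy_link)
    from that(2) have "p = 0 \<or> p = 1" by auto
    with that(1) show "lossy_link (root_after G r p)"
      unfolding lossy_link_def root_after_def by (elim disjE) simp_all
  qed
  have ex: "\<exists>v. dec G r p v" if "lossy_link G" "p \<le> 1" for G r p
    using consensus_termination[OF sol adm[OF that], of p] that unfolding dec_def by auto
  have uniq: "v = w" if "lossy_link G" "p \<le> 1" "dec G r p v" "dec G r p w" for G r p v w
    using consensus_agreement[OF sol adm[OF that(1,2)], of p p] that unfolding dec_def by auto
  \<comment> \<open>Cut off from the start, \<open>p\<close> cannot exclude that all inputs equal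
    its own; validity then fixes its decision.\<close>
  have init: "dec (\<lambda>_. star 1 0) 0 p (inp p)" if p: "p \<le> 1" for p
  proof -
    let ?G = "root_after (\<lambda>_. star 1 0) 0 p"
    have ll: "lossy_link (\<lambda>_. star 1 0)" by (simp add: lossy_link_def)
    have "decides A {..1} (\<lambda>_. inp p) ?G p (inp p)"
      by (rule consensus_unanimous[OF sol adm[OF ll p]]) (use p in auto)
    moreover have "run A {..1} (\<lambda>_. inp p) ?G k p = run A {..1} inp ?G k p" for k
      by (rule run_same_view[where S = "\<lambda>_. {p}"]) (auto simp: root_after_def in_parent_graph)
    ultimately show ?thesis unfolding dec_def decides_def by simp
  qed
  have base: "bival 0 (\<lambda>_. star 1 0)"
    using init[of 0] init[of 1] unfolding bival_def by (auto simp: lossy_link_def inp_def)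
  have step: "\<exists>G'. bival (Suc r) G' \<and> (\<forall>k\<le>r. G' k = G k)" if biv: "bival r G" for r G
  proof (rule ccontr)
    assume no: "\<not> ?thesis"
    obtain v where ll: "lossy_link G" and v0: "dec G r 0 v" and v1: "dec G r 1 (\<not> v)"
      using biv unfolding bival_def by blast
    define ext where "ext = (\<lambda>E. G(Suc r := E))"
    \<comment> \<open>Without a bivalent extension, losing the message to 0 makes both decisions
      \<open>v\<close>, and losing the message to 1 makes both its negation. If both messages
      arrive, 1 sees what it sees in \<open>?Z\<close> and 0 what it sees in \<open>?O\<close>, so
      they disagree.\<close>
    let ?Z = "ext (star 1 0)" and ?O = "ext (star 1 1)" and ?B = "ext (parent_graph 1 (\<lambda>q. 1 - q))"
    have lls: "lossy_link ?Z" "lossy_link ?O" "lossy_link ?B"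
      using ll unfolding lossy_link_def ext_def by auto
    have same: "w = u" if "lossy_link (ext E)" "dec (ext E) (Suc r) 0 w" "dec (ext E) (Suc r) 1 u" for E w u
    proof (rule ccontr)
      assume "w \<noteq> u"
      then have "u = (\<not> w)" by blast
      then have "bival (Suc r) (ext E)" unfolding bival_def using that by blast
      moreover have "\<forall>k\<le>r. ext E k = G k" by (simp add: ext_def)
      ultimately show False using no by blast
    qed
    \<comment> \<open>The added star is the graph that isolating its centre puts there
      anyway.\<close>
    have "root_after ?Z (Suc r) 0 = root_after G r 0" "root_after ?O (Suc r) 1 = root_after G r 1"
      by (auto simp: root_after_def ext_def fun_eq_iff)
    then have Z0: "dec ?Z (Suc r) 0 v" and O1: "dec ?O (Suc r) 1 (\<not> v)"
      using v0 v1 unfolding dec_def by simp_all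
    obtain w where Z1: "dec ?Z (Suc r) 1 w" using ex lls by blast
    obtain u where O0: "dec ?O (Suc r) 0 u" using ex lls by blast
    have "w = v" using same[OF lls(1) Z0 Z1] by simp
    moreover have "u = (\<not> v)" using same[OF lls(2) O0 O1] by simp
    moreover have "dec ?B (Suc r) 1 w"
      using Z1 unfolding dec_def
      by (subst decides_root_after_cong[of 1 r ?B ?Z]) (auto simp: ext_def in_parent_graph)
    moreover have "dec ?B (Suc r) 0 u"
      using O0 unfolding dec_def
      by (subst decides_root_after_cong[of 0 r ?B ?O]) (auto simp: ext_def in_parent_graph)
    ultimately show False using same[OF lls(3)] by blast
  qed
  obtain H where H: "\<And>r. bival r (H r)" "\<And>r k. k \<le> r \<Longrightarrow> H (Suc r) k = H r k"
    using dependent_nat_choice[where P = bival and Q = "\<lambda>r G G'. \<forall>k\<le>r. G' k = G k"] base step by metis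
  \<comment> \<open>The diagonal is a limit of bivalent prefixes: round \<open>k\<close> no longer
    changes after stage \<open>k\<close> of \<open>H\<close>.\<close>
  define G where "G = (\<lambda>k. H k k)"
  have HG: "H (k + j) k = G k" for k j
    by (induction j) (simp_all add: G_def H(2))
  have eq: "root_after (H r) r p = root_after G r p" for r p
  proof -
    have "H r k = G k" if "k \<le> r" for k
      using HG[of k "r - k"] that by simp
    then show ?thesis by (simp add: root_after_def fun_eq_iff)
  qed
  have ll: "lossy_link G" using H(1) unfolding bival_def lossy_link_def G_def by blast
  note admG = EV_STABLE_lossy_link[OF ll]
  obtain w0 w1 where w: "decides A {..1} inp G 0 w0" "decides A {..1} inp G 1 w1"
    using consensus_termination[OF sol admG] by fastforce
  then obtain r0 r1 where r: "alg_dec A (run A {..1} inp G r0 0) = Some w0"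
      "alg_dec A (run A {..1} inp G r1 1) = Some w1" unfolding decides_def by blast
  have "w0 = w1" using consensus_agreement[OF sol admG _ _ w] by simp
  \<comment> \<open>Cutting a process off once both have decided leaves its decision as it is,
    against the bivalence of that prefix.\<close>
  moreover have "dec G (max r0 r1) 0 w0" "dec G (max r0 r1) 1 w1"
    unfolding dec_def decides_def using r run_root_after by (metis max.cobounded1 max.cobounded2)+
  moreover obtain v where "dec G (max r0 r1) 0 v" "dec G (max r0 r1) 1 (\<not> v)"
    using H(1)[of "max r0 r1"] unfolding bival_def dec_def eq by blast
  ultimately show False using uniq[OF ll] by (metis (full_types) le_1_cases)
qed

section \<open>Larger dynamic diameters\<close>

text \<open>The path towards the root \<open>\<rho>\<close>, except that 0 skips 1: seen from a root above 1, the
  processes 0 and 1 are twins at the same distance.\<close>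

definition toward :: "nat \<Rightarrow> nat \<Rightarrow> nat" where
  "toward \<rho> q = (if q < \<rho> then if q = 0 \<and> \<rho> \<ge> 2 then 2 else q + 1 else if q > \<rho> then q - 1 else q)"

lemma toward_le: "\<rho> \<le> n \<Longrightarrow> q \<le> n \<Longrightarrow> toward \<rho> q \<le> n"
  by (auto simp: toward_def)

lemma rooted_with_toward: "\<rho> \<le> n \<Longrightarrow> rooted_with {..n} (parent_graph n (toward \<rho>)) {\<rho>}"
  by (rule rooted_with_parent_graph[where m = "\<lambda>q. (q - \<rho>) + (\<rho> - q)"]) (auto simp: toward_def)

definition short_root :: "nat \<Rightarrow> nat \<Rightarrow> nat" where
  "short_root D r = (if r < 2 * D then D + 1 else r mod 2)"

text \<open>For \<open>D \<ge> 2\<close>, the roots \<open>D + 1\<close> and \<open>D + 2\<close>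
  give every process up to \<open>D\<close> the same parent; among the processes up to
  \<open>D + 1\<close>, only \<open>D + 1\<close> notices a switch at once.\<close>

definition long_root :: "nat \<Rightarrow> nat \<Rightarrow> nat" where
  "long_root D r = (if r < D then D + 1
     else if r < 2 * D then if even (r - D) then D + 2 else D + 1 else r mod 2)"

definition short_seq :: "nat \<Rightarrow> nat \<Rightarrow> (nat \<times> nat) set" where
  "short_seq D r = parent_graph (D + 1) (toward (short_root D r))"

definition long_seq :: "nat \<Rightarrow> nat \<Rightarrow> nat \<Rightarrow> (nat \<times> nat) set" where
  "long_seq D T r = (if r \<le> T then parent_graph (D + 2 + T) (toward (long_root D r))
     else star (D + 2 + T) (D + 2 + T))"

section \<open>Admissibility of the two sequences\<close>

lemma short_root_le: "D \<ge> 2 \<Longrightarrow> short_root D r \<le> D + 1"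
  by (auto simp: short_root_def)

lemma long_root_le: "D \<ge> 2 \<Longrightarrow> long_root D r \<le> D + 2"
  by (auto simp: long_root_def)

lemma rooted_short: "D \<ge> 2 \<Longrightarrow> rooted_with {..D + 1} (short_seq D r) {short_root D r}"
  unfolding short_seq_def by (rule rooted_with_toward) (rule short_root_le)

lemma rooted_long:
  "D \<ge> 2 \<Longrightarrow> rooted_with {..D + 2 + T} (long_seq D T r) {if r \<le> T then long_root D r else D + 2 + T}"
  unfolding long_seq_def using long_root_le[of D r]
  by (auto intro!: rooted_with_toward rooted_with_star)

text \<open>The last hypothesis compares \<open>k\<close> with the distance from
  \<open>D + 1\<close>. The twin shortcut puts 0 at distance \<open>D\<close>, so \<open>D\<close>
  rounds reach everybody.\<close>

lemma cpk_short:
  assumes "D \<ge> 2" and "a + k < 2 * D" and "j \<le> D + 1" and "(if j = 0 then D else D + 1 - j) \<le> k"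
  shows "D + 1 \<in> cpk (short_seq D) a j k"
  using assms(2-)
proof (induction k arbitrary: j)
  case 0
  then show ?case using assms(1) by (auto split: if_splits)
next
  case (Suc k)
  let ?y = "toward (D + 1) j"
  have "(?y, j) \<in> short_seq D (a + Suc k)"
    using Suc.prems by (simp add: short_seq_def short_root_def in_parent_graph)
  moreover have "D + 1 \<in> cpk (short_seq D) a ?y k"
    by (rule Suc.IH) (use Suc.prems assms(1) in \<open>auto simp: toward_def split: if_splits\<close>)
  ultimately show ?case by auto
qed

lemma short_root_changes:
  assumes "D \<ge> 2" and "2 * D \<le> Suc r"
  shows "short_root D (Suc r) \<noteq> short_root D r"
proof (cases "r < 2 * D")
  case True
  have "Suc r mod 2 < 2" by simp
  then show ?thesis using True assms by (simp add: short_root_def)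
next
  case False
  have "Suc r mod 2 \<noteq> r mod 2" by presburger
  then show ?thesis using False by (simp add: short_root_def)
qed

lemma EV_STABLE_short:
  assumes D: "D \<ge> 2" and "x < 2 * D"
  shows "EV_STABLE D x {..D + 1} (short_seq D)"
  unfolding EV_STABLE_def
proof (intro conjI)
  note root = rooted_short[OF D]
  show "graph_seq {..D + 1} (short_seq D)"
    by (rule graph_seq_parent_graph) (metis toward_le short_root_le[OF D] short_seq_def)
  show "ROOTED {..D + 1} (short_seq D)" unfolding ROOTED_def rooted_def using root by blast
  have "rooted_with {..D + 1} (short_seq D r) {D + 1}" if "r < 2 * D" for r
    using root[of r] that by (simp add: short_root_def)
  then show "EV_STABILITY x {..D + 1} (short_seq D)"
    unfolding EV_STABILITY_def using assms(2) by (intro exI[of _ "{D + 1}"] exI[of _ 1]) auto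
  show "DIAM D {..D + 1} (short_seq D)"
    unfolding DIAM_def CP_def
  proof (intro allI impI ballI)
    fix r1 R p
    assume r1: "1 \<le> r1" and R: "\<forall>r\<in>{r1..<r1 + D}. rooted_with {..D + 1} (short_seq D r) R"
      and p: "p \<in> {..D + 1}"
    have R': "R = {short_root D r}" if "r1 \<le> r" "r < r1 + D" for r
      by (rule rooted_with_unique[OF _ root]) (use R that in auto)
    \<comment> \<open>A window starting later ends in round \<open>2 * D\<close> or after, where its
      last two rounds have different roots.\<close>
    have le: "r1 \<le> D"
    proof (rule ccontr)
      assume "\<not> r1 \<le> D"
      then have "Suc (r1 + D - 2) = r1 + D - 1" "2 * D \<le> Suc (r1 + D - 2)" using D by auto
      moreover have "short_root D (r1 + D - 2) = short_root D (r1 + D - 1)"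
        using R'[of "r1 + D - 2"] R'[of "r1 + D - 1"] D r1 by simp
      ultimately show False using short_root_changes[OF D, of "r1 + D - 2"] by simp
    qed
    have "R = {D + 1}" using R'[of r1] le D by (simp add: short_root_def)
    moreover have "D + 1 \<in> cpk (short_seq D) (r1 - 1) p D"
      by (rule cpk_short[OF D]) (use le r1 p D in auto)
    moreover have "r1 + D - 1 - (r1 - 1) = D" using r1 by simp
    ultimately show "R \<subseteq> cpk (short_seq D) (r1 - 1) p (r1 + D - 1 - (r1 - 1))" by simp
  qed
qed

text \<open>Roots repeat only within rounds 1 to \<open>D - 1\<close>, one round short of a
  window.\<close>

lemma long_root_changes:
  assumes "D \<ge> 2" and "1 \<le> r" and "long_root D (Suc r) = long_root D r"
  shows "Suc r < D"
proof (rule ccontr)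
  assume "\<not> Suc r < D"
  then consider "Suc r = D" | "D \<le> r" "Suc r < 2 * D" | "Suc r = 2 * D" | "2 * D \<le> r" by linarith
  then show False
  proof cases
    case 2
    then have "Suc r - D = Suc (r - D)" by simp
    then show ?thesis using 2 assms by (auto simp: long_root_def split: if_splits)
  next
    case 4
    then show ?thesis using assms by (auto simp: long_root_def) presburger
  qed (use assms in \<open>auto simp: long_root_def split: if_splits\<close>)
qed

text \<open>The eternal star after round \<open>T\<close> supplies stability of any length and
  spreads its root in one round.\<close>

lemma EV_STABLE_long:
  assumes D: "D \<ge> 2" and T: "D < T"
  shows "EV_STABLE D x {..D + 2 + T} (long_seq D T)"
  unfolding EV_STABLE_def
proof (intro conjI)
  let ?N = "D + 2 + T"
  note root = rooted_long[OF D, of T]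
  show gs: "graph_seq {..?N} (long_seq D T)"
  proof (rule graph_seq_parent_graph)
    fix r
    have "toward (long_root D r) q \<le> ?N" if "q \<le> ?N" for q
      by (rule toward_le) (use long_root_le[OF D, of r] that in auto)
    then show "\<exists>f. long_seq D T r = parent_graph ?N f \<and> (\<forall>q\<le>?N. f q \<le> ?N)"
      unfolding long_seq_def by (cases "r \<le> T") auto
  qed
  show "ROOTED {..?N} (long_seq D T)" unfolding ROOTED_def rooted_def using root by blast
  have "rooted_with {..?N} (long_seq D T r) {?N}" if "r > T" for r
    using root[of r] that by simp
  then show "EV_STABILITY x {..?N} (long_seq D T)"
    unfolding EV_STABILITY_def by (intro exI[of _ "{?N}"] exI[of _ "Suc T"]) auto
  show "DIAM D {..?N} (long_seq D T)"
    unfolding DIAM_def CP_def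
  proof (intro allI impI ballI)
    fix r1 R p
    assume r1: "1 \<le> r1" and R: "\<forall>r\<in>{r1..<r1 + D}. rooted_with {..?N} (long_seq D T r) R"
      and p: "p \<in> {..?N}"
    have R': "R = {if r \<le> T then long_root D r else ?N}" if "r1 \<le> r" "r < r1 + D" for r
      by (rule rooted_with_unique[OF _ root]) (use R that in auto)
    \<comment> \<open>A window starting by round \<open>T\<close> would repeat the root in its first
      two rounds, hence start early and contain round \<open>D\<close>, where the root switches to
      \<open>D + 2\<close>.\<close>
    have gt: "r1 > T"
    proof (rule ccontr)
      assume "\<not> r1 > T"
      then have le: "r1 \<le> T" by simp
      have eq: "long_root D r1 = (if Suc r1 \<le> T then long_root D (Suc r1) else ?N)"
        using R'[of r1] R'[of "Suc r1"] D le by simp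
      then have "long_root D (Suc r1) = long_root D r1"
        using long_root_le[OF D, of r1] T by (auto split: if_splits)
      then have "Suc r1 < D" using long_root_changes[OF D r1] by simp
      then show False using R'[of r1] R'[of D] r1 le T by (simp add: long_root_def)
    qed
    obtain k where k: "D = Suc k" using D by (cases D) auto
    have "R = {?N}" using R'[of r1] gt D by simp
    moreover have "(?N, p) \<in> long_seq D T (r1 - 1 + Suc k)"
      using gt p by (simp add: long_seq_def in_parent_graph)
    moreover have "?N \<in> cpk (long_seq D T) (r1 - 1) ?N k"
      by (rule cpk_self) (use gs in \<open>auto simp: graph_seq_def\<close>)
    moreover have "r1 + D - 1 - (r1 - 1) = Suc k" using r1 k by simp
    ultimately show "R \<subseteq> cpk (long_seq D T) (r1 - 1) p (r1 + D - 1 - (r1 - 1))" by auto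
  qed
qed

text \<open>Process 0 at distance \<open>D\<close> has not yet learnt by round \<open>2 * D - 1\<close> that \<open>D + 1\<close> loses its
  root status in round \<open>D\<close>; afterwards 0 and 1 only hear each other.\<close>

lemma short_long_same_view:
  assumes D: "D \<ge> 2" and "t \<le> T" and inp: "\<And>q. q \<le> D + 1 \<Longrightarrow> inp q = inp' q"
  shows "run A {..D + 1} inp (short_seq D) t 0 = run A {..D + 2 + T} inp' (long_seq D T) t 0"
proof -
  \<comment> \<open>Process \<open>D + 1\<close> first sees a difference in round \<open>D\<close>,
    and the news moves down one process per round; hence the bound \<open>j + r \<le> 2 * D\<close>.
    The cut at \<open>T\<close> stops before the final star.\<close>
  let ?S = "\<lambda>r. if r \<le> T then {j. j \<le> D + 1 \<and> (j \<le> 1 \<or> j + r \<le> 2 * D)} else {}"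
  have par: "toward (short_root D (Suc r)) q = toward (long_root D (Suc r)) q"
    "toward (short_root D (Suc r)) q \<in> ?S r" if "q \<in> ?S (Suc r)" for r q
    using that D by (auto simp: toward_def short_root_def long_root_def split: if_splits)
  show ?thesis
  proof (rule run_same_view[where S = ?S])
    fix r p q assume q: "q \<in> ?S (Suc r)"
    then have le: "q \<le> D + 1" "Suc r \<le> T" by (auto split: if_splits)
    show "p \<in> {..D + 1} \<and> (p, q) \<in> short_seq D (Suc r) \<longleftrightarrow>
        p \<in> {..D + 2 + T} \<and> (p, q) \<in> long_seq D T (Suc r)"
      using par[OF q] le by (auto simp: short_seq_def long_seq_def in_parent_graph split: if_splits)
    show "(p, q) \<in> short_seq D (Suc r) \<Longrightarrow> p \<in> ?S r"
      using par[OF q] q by (auto simp: short_seq_def in_parent_graph split: if_splits)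
  qed (use assms in \<open>auto split: if_splits\<close>)
qed

text \<open>Through round \<open>T\<close> messages climb the tail one process per round, so inputs
  below \<open>D + 2\<close> get no further than process \<open>D + 1 + T\<close>; afterwards the
  far end hears only itself.\<close>

lemma far_end_same_view:
  assumes D: "D \<ge> 2" and inp: "\<And>q. D + 2 \<le> q \<Longrightarrow> inp q = inp' q"
  shows "run A {..D + 2 + T} inp (long_seq D T) t (D + 2 + T) =
    run A {..D + 2 + T} inp' (long_seq D T) t (D + 2 + T)"
proof (rule run_same_view[where S = "\<lambda>r. {j. j = D + 2 + T \<or> D + 2 + r \<le> j}"])
  fix r p q
  assume q: "q \<in> {j. j = D + 2 + T \<or> D + 2 + Suc r \<le> j}" and pq: "(p, q) \<in> long_seq D T (Suc r)"
  show "p \<in> {j. j = D + 2 + T \<or> D + 2 + r \<le> j}"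
  proof (cases "Suc r \<le> T")
    case True
    then have "toward (long_root D (Suc r)) q = q - 1"
      using q long_root_le[OF D, of "Suc r"] by (auto simp: toward_def)
    then show ?thesis using pq q True by (auto simp: long_seq_def in_parent_graph)
  next
    case False
    then show ?thesis using pq q by (auto simp: long_seq_def in_parent_graph)
  qed
qed (use inp in auto)

lemma no_uniform_consensus_ge_2:
  assumes D: "D \<ge> 2" and x: "x < 2 * D"
    and sol: "\<And>n. solves_consensus A {..n} (EV_STABLE D x {..n})"
  shows False
proof -
  have "decides A {..D + 1} (\<lambda>_. False) (short_seq D) 0 False"
    by (rule consensus_unanimous[OF sol EV_STABLE_short[OF D x]]) auto
  then obtain t where t: "alg_dec A (run A {..D + 1} (\<lambda>_. False) (short_seq D) t 0) = Some False"
    unfolding decides_def by blast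
  \<comment> \<open>\<open>T \<ge> t\<close> keeps the decision of 0 inside the common view;
    \<open>T > D\<close> makes the long sequence admissible.\<close>
  define T where "T = max t (D + 1)"
  let ?N = "D + 2 + T" and ?inp = "\<lambda>q. D + 2 \<le> q"
  have adm: "EV_STABLE D x {..?N} (long_seq D T)"
    by (rule EV_STABLE_long[OF D]) (simp add: T_def)
  have "run A {..D + 1} (\<lambda>_. False) (short_seq D) t 0 = run A {..?N} ?inp (long_seq D T) t 0"
    by (rule short_long_same_view[OF D]) (auto simp: T_def)
  then have "decides A {..?N} ?inp (long_seq D T) 0 False"
    using t unfolding decides_def by auto
  moreover have "decides A {..?N} ?inp (long_seq D T) ?N True"
  proof -
    have "decides A {..?N} (\<lambda>_. True) (long_seq D T) ?N True"
      by (rule consensus_unanimous[OF sol adm]) auto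
    then show ?thesis
      using far_end_same_view[OF D, of ?inp "\<lambda>_. True" A T] unfolding decides_def by simp
  qed
  ultimately show False using consensus_agreement[OF sol adm, of 0 ?N] by auto
qed

theorem theorem1:
  fixes D x :: nat
  assumes "D \<ge> 1" and "0 < x" and "x < 2 * D"
  shows "\<not> (\<exists>A :: ('s, 'm) cons_alg. \<forall>Pi :: nat set. finite Pi \<and> Pi \<noteq> {} \<longrightarrow>
              solves_consensus A Pi (EV_STABLE D x Pi))"
proof
  assume "\<exists>A :: ('s, 'm) cons_alg. \<forall>Pi :: nat set. finite Pi \<and> Pi \<noteq> {} \<longrightarrow>
              solves_consensus A Pi (EV_STABLE D x Pi)"
  then obtain A :: "('s, 'm) cons_alg" where
    "\<forall>Pi. finite Pi \<and> Pi \<noteq> {} \<longrightarrow> solves_consensus A Pi (EV_STABLE D x Pi)" by blast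
  then have sol: "solves_consensus A {..n} (EV_STABLE D x {..n})" for n by simp
  show False
  \<comment> \<open>For \<open>D = 1\<close> each single round is already a stable window, so the
    diameter condition is never vacuous and a long tail is ruled out.\<close>
  proof (cases "D = 1")
    case True
    then have "x = 1" using assms by simp
    then show False using sol[of 1] True no_consensus_lossy_link[of A] by simp
  next
    case False
    then show False using no_uniform_consensus_ge_2[OF _ assms(3) sol] assms(1) by simp
  qed
qed

end
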